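(* Let $A\in\mathbb{R}^{n\times n}$. If there exists an $\bar\varepsilon>0$ such that for any $\varepsilon\in[0,\bar\varepsilon]$ and any integer $\ell>0$ the matrix $(I+\varepsilon A)^\ell$ is sign-symmetric, then $A$ is an EP-matrix.
   Context: A matrix in $\mathbb{R}^{n\times n}$ is called a P-matrix if all its principal minors are positive. A matrix $A\in\mathbb{R}^{n\times n}$ is called an EP-matrix (exponential P-matrix) if $\exp(At)$ is a P-matrix for all $t\ge 0$. A matrix $M\in\mathbb{R}^{n\times n}$ is called sign-symmetric if for any $k\in\{1,\dots,n\}$ and any $\alpha,\beta\in Q^{k,n}$ we have $M(\alpha|\beta)M(\beta|\alpha)\ge 0$, where $Q^{k,n}$ is the set of increasing sequences of $k$ numbers from $\{1,\dots,n\}$ and $M(\alpha|\beta)$ is the minor of $M$ with row indices $\alpha$ and column indices $\beta$. *)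

theory Defs
  imports Complex_Main "Jordan_Normal_Form.Determinant" "Jordan_Normal_Form.DL_Submatrix"
begin

(* Rows and columns are numbered 0, ..., n-1.  An increasing sequence of k indices is
   represented by the set of its members; submatrix selects rows and columns in
   increasing order of their indices. *)

definition index_sets :: "nat \<Rightarrow> nat \<Rightarrow> nat set set" where
  "index_sets k n = {\<alpha>. \<alpha> \<subseteq> {..<n} \<and> card \<alpha> = k}"

definition minor :: "real mat \<Rightarrow> nat set \<Rightarrow> nat set \<Rightarrow> real" where
  "minor M \<alpha> \<beta> = det (submatrix M \<alpha> \<beta>)"

definition P_matrix :: "real mat \<Rightarrow> bool" where
  "P_matrix M \<longleftrightarrow> square_mat M \<and>
     (\<forall>k\<in>{1..dim_row M}. \<forall>\<alpha>\<in>index_sets k (dim_row M). minor M \<alpha> \<alpha> > 0)"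

definition sign_symmetric :: "real mat \<Rightarrow> bool" where
  "sign_symmetric M \<longleftrightarrow> square_mat M \<and>
     (\<forall>k\<in>{1..dim_row M}. \<forall>\<alpha>\<in>index_sets k (dim_row M). \<forall>\<beta>\<in>index_sets k (dim_row M).
        minor M \<alpha> \<beta> * minor M \<beta> \<alpha> \<ge> 0)"

(* The power series is summed entrywise; mat_exp_summable shows that for square matrices
   every entry converges, so suminf is not used outside its domain. *)

definition mat_exp :: "real mat \<Rightarrow> real mat" where
  "mat_exp A = mat (dim_row A) (dim_col A) (\<lambda>(i, j). \<Sum>k. (A ^\<^sub>m k) $$ (i, j) / fact k)"

definition EP_matrix :: "real mat \<Rightarrow> bool" where
  "EP_matrix A \<longleftrightarrow> square_mat A \<and> (\<forall>t::real. t \<ge> 0 \<longrightarrow> P_matrix (mat_exp (t \<cdot>\<^sub>m A)))"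

lemma pow_mat_entry_bound:
  fixes A :: "real mat"
  assumes A: "A \<in> carrier_mat n n"
    and c: "\<And>i j. i < n \<Longrightarrow> j < n \<Longrightarrow> \<bar>A $$ (i, j)\<bar> \<le> c"
    and i: "i < n" and j: "j < n"
  shows "\<bar>(A ^\<^sub>m k) $$ (i, j)\<bar> \<le> (real n * c) ^ k"
  using j
proof (induction k arbitrary: j)
  case 0
  then show ?case using A i by simp
next
  case (Suc k)
  have "\<bar>A $$ (i, i)\<bar> \<le> c" using c i by blast
  then have c0: "0 \<le> c" by linarith
  have Ak: "A ^\<^sub>m k \<in> carrier_mat n n" using A by simp
  have "(A ^\<^sub>m Suc k) $$ (i, j) = (\<Sum>l\<in>{0..<n}. (A ^\<^sub>m k) $$ (i, l) * A $$ (l, j))"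
    using A Ak i Suc.prems by (simp add: scalar_prod_def)
  also have "\<bar>\<dots>\<bar> \<le> (\<Sum>l\<in>{0..<n}. \<bar>(A ^\<^sub>m k) $$ (i, l) * A $$ (l, j)\<bar>)"
    by (rule sum_abs)
  also have "\<dots> \<le> (\<Sum>l\<in>{0..<n}. (real n * c) ^ k * c)"
    unfolding abs_mult
    by (intro sum_mono mult_mono Suc.IH c) (use Suc.prems c0 in auto)
  also have "\<dots> = (real n * c) ^ Suc k"
    by (simp add: mult_ac)
  finally show ?case .
qed

lemma mat_exp_summable:
  fixes A :: "real mat"
  assumes A: "A \<in> carrier_mat n n" and i: "i < n" and j: "j < n"
  shows "summable (\<lambda>k. (A ^\<^sub>m k) $$ (i, j) / fact k)"
proof -
  define c where "c = (\<Sum>p\<in>{..<n} \<times> {..<n}. \<bar>A $$ p\<bar>)"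
  have c: "\<bar>A $$ (i, j)\<bar> \<le> c" if "i < n" "j < n" for i j
    unfolding c_def by (rule member_le_sum) (use that in auto)
  have *: "norm ((A ^\<^sub>m k) $$ (i, j) / fact k) \<le> inverse (fact k) * (real n * c) ^ k" for k
    using pow_mat_entry_bound[OF A c i j, of k] by (simp add: field_simps)
  show ?thesis
    by (rule summable_comparison_test'[OF summable_exp *])
qed

end

theory Submission
  imports Defs "HOL-Analysis.Uniform_Limit"
begin

text \<open>The Cauchy--Binet formula gives
  \<open>M\<^sup>2(\<alpha>|\<alpha>) = (\<Sum>\<beta>. M(\<alpha>|\<beta>) M(\<beta>|\<alpha>))\<close>, so \<open>M\<^sup>2(\<alpha>|\<alpha>) \<ge> M(\<alpha>|\<alpha>)\<^sup>2\<close> for sign-symmetric \<open>M\<close>.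
  Starting from \<open>I + (t / 2\<^sup>m) A\<close> and squaring \<open>m\<close> times, with
  \<open>(I + \<epsilon> A)(\<alpha>|\<alpha>) \<ge> 1 - C \<epsilon>\<close> for small \<open>\<epsilon>\<close>, one obtains the lower bound
  \<open>(1 - C t / 2\<^sup>m) ^ 2\<^sup>m\<close> for the minor of \<open>(I + (t / 2\<^sup>m) A) ^ 2\<^sup>m\<close>. As \<open>m \<rightarrow> \<infinity>\<close> the matrices
  converge to \<open>exp (t A)\<close> and the lower bounds to \<open>exp (- C t) > 0\<close>.\<close>

section \<open>The Cauchy--Binet formula\<close>

lemma index_setsD:
  assumes "\<beta> \<in> index_sets k n"
  shows "\<beta> \<subseteq> {..<n}" "card \<beta> = k" "finite \<beta>" "{i. i < n \<and> i \<in> \<beta>} = \<beta>"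
  using assms finite_subset[of \<beta> "{..<n}"] by (auto simp: index_sets_def)

lemma finite_index_sets: "finite (index_sets k n)"
  by (rule finite_subset[of _ "Pow {..<n}"]) (auto simp: index_sets_def)

lemma pick_inj_on: "inj_on (pick S) {0..<card S}"
proof (rule inj_onI)
  fix x y assume "x \<in> {0..<card S}" "y \<in> {0..<card S}" "pick S x = pick S y"
  then show "x = y"
    using pick_mono_le[of x S y] pick_mono_le[of y S x] by (cases x y rule: linorder_cases) auto
qed

lemma bij_betw_pick:
  assumes "finite S"
  shows "bij_betw (pick S) {0..<card S} S"
proof -
  have "pick S ` {0..<card S} \<subseteq> S" using pick_in_set_le by auto
  moreover have "card (pick S ` {0..<card S}) = card S"
    using card_image[OF pick_inj_on[of S]] by simp
  ultimately have "pick S ` {0..<card S} = S"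
    using card_subset_eq[OF assms] by blast
  then show ?thesis using pick_inj_on by (simp add: bij_betw_def)
qed

text \<open>Every injective choice of indices with image \<open>\<beta>\<close> is the increasing
  enumeration \<open>pick \<beta>\<close> after exactly one permutation. The identity outside
  \<open>{0..<k}\<close>, which \<open>permutes\<close> demands, makes such a choice determined by
  its values on \<open>{0..<k}\<close>.\<close>

lemma functions_onto_index_set:
  assumes \<beta>: "\<beta> \<in> index_sets k n"
  shows "bij_betw (\<lambda>\<sigma> i. if i < k then pick \<beta> (\<sigma> i) else i)
    {\<sigma>. \<sigma> permutes {0..<k}}
    {f. inj_on f {0..<k} \<and> f ` {0..<k} = \<beta> \<and> (\<forall>i. i \<notin> {0..<k} \<longrightarrow> f i = i)}"
    (is "bij_betw ?h ?P ?F")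
proof -
  note D = index_setsD[OF \<beta>]
  have pick: "bij_betw (pick \<beta>) {0..<k} \<beta>" using bij_betw_pick[OF D(3)] D(2) by simp
  show ?thesis
  \<comment> \<open>The inverse replaces each value of \<open>f\<close> by its position in the
    increasing enumeration of \<open>\<beta>\<close>.\<close>
  proof (rule bij_betw_byWitness[where f' = "\<lambda>f i. if i < k then inv_into {0..<k} (pick \<beta>) (f i) else i"])
    show "\<forall>\<sigma>\<in>?P. (\<lambda>i. if i < k then inv_into {0..<k} (pick \<beta>) (?h \<sigma> i) else i) = \<sigma>"
    proof (intro ballI ext)
      fix \<sigma> i assume "\<sigma> \<in> ?P"
      then have \<sigma>: "\<sigma> permutes {0..<k}" by simp
      show "(if i < k then inv_into {0..<k} (pick \<beta>) (?h \<sigma> i) else i) = \<sigma> i"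
        using permutes_in_image[OF \<sigma>, of i] permutes_not_in[OF \<sigma>, of i]
          inv_into_f_f[OF bij_betw_imp_inj_on[OF pick], of "\<sigma> i"] by auto
    qed
    show "\<forall>f\<in>?F. ?h (\<lambda>i. if i < k then inv_into {0..<k} (pick \<beta>) (f i) else i) = f"
    proof (intro ballI ext)
      fix f i assume "f \<in> ?F"
      then show "?h (\<lambda>i. if i < k then inv_into {0..<k} (pick \<beta>) (f i) else i) i = f i"
        using bij_betw_inv_into_right[OF pick, of "f i"] by auto
    qed
    show "?h ` ?P \<subseteq> ?F"
    proof (rule image_subsetI)
      fix \<sigma> assume "\<sigma> \<in> ?P"
      then have "bij_betw (pick \<beta> \<circ> \<sigma>) {0..<k} \<beta>"
        using permutes_imp_bij bij_betw_trans pick by blast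
      then have "bij_betw (?h \<sigma>) {0..<k} \<beta>"
        by (rule bij_betw_cong[THEN iffD1, rotated]) auto
      then show "?h \<sigma> \<in> ?F" by (auto simp: bij_betw_def)
    qed
    show "(\<lambda>f i. if i < k then inv_into {0..<k} (pick \<beta>) (f i) else i) ` ?F \<subseteq> ?P"
    proof (rule image_subsetI)
      fix f assume f: "f \<in> ?F"
      then have "bij_betw (inv_into {0..<k} (pick \<beta>) \<circ> f) {0..<k} {0..<k}"
        using bij_betw_trans bij_betw_inv_into[OF pick] by (fastforce simp: bij_betw_def)
      then have "bij_betw (\<lambda>i. if i < k then inv_into {0..<k} (pick \<beta>) (f i) else i) {0..<k} {0..<k}"
        by (rule bij_betw_cong[THEN iffD1, rotated]) auto
      then show "(\<lambda>i. if i < k then inv_into {0..<k} (pick \<beta>) (f i) else i) \<in> ?P"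
        by (auto intro!: bij_imp_permutes)
    qed
  qed
qed

text \<open>Each row of \<open>P * Q\<close> is a combination of rows of \<open>Q\<close>, so
  multilinearity expands the determinant over all choices \<open>f\<close> of rows of
  \<open>Q\<close>. Choices with a repetition contribute zero. The others are grouped by their image
  \<open>\<beta>\<close>; within a group the signs of the permutations assemble the Leibniz formula
  for the submatrix of \<open>P\<close>.\<close>

lemma det_mult_Cauchy_Binet:
  fixes P Q :: "'a :: comm_ring_1 mat"
  assumes P: "P \<in> carrier_mat k n" and Q: "Q \<in> carrier_mat n k"
  shows "det (P * Q) =
    (\<Sum>\<beta>\<in>index_sets k n. det (submatrix P UNIV \<beta>) * det (submatrix Q \<beta> UNIV))"
proof -
  let ?U = "{0..<k}"
  let ?F = "{f. (\<forall>i\<in>?U. f i \<in> {0..<n}) \<and> (\<forall>i. i \<notin> ?U \<longrightarrow> f i = i)}"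
  let ?I = "{f \<in> ?F. inj_on f ?U}"
  define T where "T f = (\<Prod>i\<in>?U. P $$ (i, f i)) * det (mat\<^sub>r k k (\<lambda>i. Matrix.row Q (f i)))" for f
  have finF: "finite ?F" by (rule finite_bounded_functions) auto
  have "det (P * Q) = (\<Sum>f\<in>?F. det (mat\<^sub>r k k (\<lambda>i. P $$ (i, f i) \<cdot>\<^sub>v Matrix.row Q (f i))))"
    unfolding mat_mul_finsum_alt[OF P Q]
    by (rule det_linear_rows_sum) (use P Q in auto)
  also have "\<dots> = sum T ?F"
    unfolding T_def by (rule sum.cong[OF refl], rule det_rows_mul) (use Q in auto)
  also have "\<dots> = sum T ?I"
  proof (rule sum.mono_neutral_right[OF finF])
    show "\<forall>f\<in>?F - ?I. T f = 0"
    proof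
      fix f assume "f \<in> ?F - ?I"
      then have "\<not> inj_on f ?U" by auto
      then obtain i j where ij: "i \<noteq> j" "i < k" "j < k" and eq: "f i = f j"
        unfolding inj_on_def by auto
      have "Matrix.row (mat\<^sub>r k k (\<lambda>i. Matrix.row Q (f i))) i = Matrix.row (mat\<^sub>r k k (\<lambda>i. Matrix.row Q (f i))) j"
        using ij Q by (simp add: eq)
      from det_identical_rows[OF mat_row_carrierI ij this] show "T f = 0"
        by (simp add: T_def)
    qed
  qed auto
  also have "\<dots> = (\<Sum>\<beta>\<in>index_sets k n. \<Sum>f\<in>{f \<in> ?I. f ` ?U = \<beta>}. T f)"
    by (rule sum.group[symmetric])
      (auto intro: finite_subset[OF _ finF] simp: finite_index_sets index_sets_def card_image)
  also have "\<dots> = (\<Sum>\<beta>\<in>index_sets k n. det (submatrix P UNIV \<beta>) * det (submatrix Q \<beta> UNIV))"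
  proof (rule sum.cong[OF refl])
    fix \<beta> assume \<beta>: "\<beta> \<in> index_sets k n"
    note D = index_setsD[OF \<beta>]
    let ?h = "\<lambda>\<sigma> i. if i < k then pick \<beta> (\<sigma> i) else i"
    let ?Q = "submatrix Q \<beta> UNIV" and ?P = "submatrix P UNIV \<beta>"
    have Qc: "?Q \<in> carrier_mat k k" and Pc: "?P \<in> carrier_mat k k"
      using P Q D by (auto simp: submatrix_def)
    have pick_less: "pick \<beta> i < n" if "i < k" for i
      using pick_in_set_le[of i \<beta>] D that by auto
    \<comment> \<open>As \<open>\<beta>\<close> lies in \<open>{..<n}\<close>, the condition on the
      image already contains the range condition of \<open>?F\<close>.\<close>
    have "{f \<in> ?I. f ` ?U = \<beta>}
        = {f. inj_on f ?U \<and> f ` ?U = \<beta> \<and> (\<forall>i. i \<notin> ?U \<longrightarrow> f i = i)}"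
      using D(1) by auto
    then have "(\<Sum>f\<in>{f \<in> ?I. f ` ?U = \<beta>}. T f) = (\<Sum>\<sigma>\<in>{\<sigma>. \<sigma> permutes ?U}. T (?h \<sigma>))"
      using sum.reindex_bij_betw[OF functions_onto_index_set[OF \<beta>], of T] by simp
    also have "\<dots> = (\<Sum>\<sigma>\<in>{\<sigma>. \<sigma> permutes ?U}.
        signof \<sigma> * (\<Prod>i\<in>?U. ?P $$ (i, \<sigma> i)) * det ?Q)"
    proof (rule sum.cong[OF refl])
      fix \<sigma> assume "\<sigma> \<in> {\<sigma>. \<sigma> permutes ?U}"
      then have \<sigma>: "\<sigma> permutes ?U" by simp
      have less: "\<sigma> i < k" if "i < k" for i using permutes_in_image[OF \<sigma>, of i] that by simp
      \<comment> \<open>The choice \<open>?h \<sigma>\<close> lists the rows of \<open>?Q\<close> in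
        the order \<open>\<sigma>\<close>, so its determinant is that of \<open>?Q\<close> up to the
        sign of \<open>\<sigma>\<close>.\<close>
      have "mat\<^sub>r k k (\<lambda>i. Matrix.row Q (?h \<sigma> i)) = Matrix.mat k k (\<lambda>(i, j). ?Q $$ (\<sigma> i, j))"
        using Q D less pick_less by (intro eq_matI) (auto simp: submatrix_def pick_UNIV)
      moreover have "(\<Prod>i\<in>?U. P $$ (i, ?h \<sigma> i)) = (\<Prod>i\<in>?U. ?P $$ (i, \<sigma> i))"
        using P D less by (intro prod.cong) (auto simp: submatrix_def pick_UNIV)
      ultimately show "T (?h \<sigma>) = signof \<sigma> * (\<Prod>i\<in>?U. ?P $$ (i, \<sigma> i)) * det ?Q"
        unfolding T_def using det_permute_rows[OF Qc \<sigma>] by (simp add: ac_simps)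
    qed
    also have "\<dots> = det ?P * det ?Q"
      by (simp add: det_def'[OF Pc] sum_distrib_right)
    finally show "(\<Sum>f\<in>{f \<in> ?I. f ` ?U = \<beta>}. T f) = det ?P * det ?Q" .
  qed
  finally show ?thesis .
qed

section \<open>Minors of a product\<close>

lemma submatrix_carrier:
  assumes "M \<in> carrier_mat n m" "\<alpha> \<in> index_sets k n" "\<beta> \<in> index_sets l m"
  shows "submatrix M \<alpha> \<beta> \<in> carrier_mat k l"
  using assms index_setsD[OF assms(2)] index_setsD[OF assms(3)] by (auto simp: submatrix_def)

lemma submatrix_index':
  assumes "M \<in> carrier_mat n m" "\<alpha> \<in> index_sets k n" "\<beta> \<in> index_sets l m" "i < k" "j < l"
  shows "submatrix M \<alpha> \<beta> $$ (i, j) = M $$ (pick \<alpha> i, pick \<beta> j)"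
  using assms index_setsD[OF assms(2)] index_setsD[OF assms(3)] by (auto simp: submatrix_def)

lemma pick_less:
  assumes "\<alpha> \<in> index_sets k n" "i < k"
  shows "pick \<alpha> i < n"
  using pick_in_set_le[of i \<alpha>] index_setsD[OF assms(1)] assms(2) by auto

text \<open>Selecting rows affects only the left factor and selecting columns only the right one.
  The submatrix of the product is thus a \<open>k\<close> by \<open>n\<close> matrix times an
  \<open>n\<close> by \<open>k\<close> matrix, and Cauchy--Binet applies; \<open>UNIV\<close> means
  that nothing is removed.\<close>

lemma minor_mult:
  assumes M: "M \<in> carrier_mat n n" and N: "N \<in> carrier_mat n n"
    and \<alpha>: "\<alpha> \<in> index_sets k n" and \<gamma>: "\<gamma> \<in> index_sets k n"
  shows "minor (M * N) \<alpha> \<gamma> = (\<Sum>\<beta>\<in>index_sets k n. minor M \<alpha> \<beta> * minor N \<beta> \<gamma>)"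
proof -
  let ?P = "submatrix M \<alpha> UNIV" and ?Q = "submatrix N UNIV \<gamma>"
  have P: "?P \<in> carrier_mat k n" and Q: "?Q \<in> carrier_mat n k"
    using M N index_setsD[OF \<alpha>] index_setsD[OF \<gamma>] by (auto simp: submatrix_def)
  have "submatrix (M * N) \<alpha> \<gamma> = ?P * ?Q"
    using M N P Q index_setsD[OF \<alpha>] index_setsD[OF \<gamma>] pick_less[OF \<alpha>] pick_less[OF \<gamma>]
    by (intro eq_matI) (auto simp: submatrix_def pick_UNIV scalar_prod_def intro!: sum.cong)
  moreover have "submatrix ?P UNIV \<beta> = submatrix M \<alpha> \<beta>"
      "submatrix ?Q \<beta> UNIV = submatrix N \<beta> \<gamma>" if "\<beta> \<in> index_sets k n" for \<beta>
    using M N P Q index_setsD[OF \<alpha>] index_setsD[OF \<gamma>] index_setsD[OF that] pick_less[OF that]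
    by (auto intro!: eq_matI simp: submatrix_def pick_UNIV)
  ultimately show ?thesis
    unfolding minor_def using det_mult_Cauchy_Binet[OF P Q] by simp
qed

section \<open>Principal minors of powers of sign-symmetric matrices\<close>

lemma sign_symmetric_minor_square:
  assumes M: "M \<in> carrier_mat n n" and sym: "sign_symmetric M"
    and \<alpha>: "\<alpha> \<in> index_sets k n" and k: "k > 0"
  shows "(minor M \<alpha> \<alpha>)\<^sup>2 \<le> minor (M * M) \<alpha> \<alpha>"
proof -
  \<comment> \<open>The definition of \<open>sign_symmetric\<close> speaks only of orders between 1
    and the dimension.\<close>
  have "k \<le> n"
    using index_setsD[OF \<alpha>] card_mono[of "{..<n}" \<alpha>] by auto
  then have "0 \<le> minor M \<alpha> \<beta> * minor M \<beta> \<alpha>" if "\<beta> \<in> index_sets k n" for \<beta>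
    using sym M \<alpha> k that unfolding sign_symmetric_def by (metis atLeastAtMost_iff carrier_matD(1) Suc_leI One_nat_def)
  then show ?thesis
    unfolding minor_mult[OF M M \<alpha> \<alpha>] power2_eq_square
    by (intro member_le_sum[OF \<alpha>]) (auto simp: finite_index_sets)
qed

lemma pow_mat_add:
  assumes "A \<in> carrier_mat n n"
  shows "A ^\<^sub>m (k + l) = A ^\<^sub>m k * A ^\<^sub>m l"
  using assms
proof (induction l)
  case (Suc l)
  then show ?case by (simp add: assoc_mult_mat[of _ n n _ n _ n])
qed auto

text \<open>Each squaring is applied to a power already formed, hence the assumption on all powers
  of \<open>M\<close>. Nonnegativity of the initial minor allows the inequality itself to be
  squared.\<close>

lemma sign_symmetric_minor_power:
  assumes M: "M \<in> carrier_mat n n" and sym: "\<And>l. l > 0 \<Longrightarrow> sign_symmetric (M ^\<^sub>m l)"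
    and \<alpha>: "\<alpha> \<in> index_sets k n" and k: "k > 0" and nonneg: "0 \<le> minor M \<alpha> \<alpha>"
  shows "minor M \<alpha> \<alpha> ^ 2 ^ m \<le> minor (M ^\<^sub>m 2 ^ m) \<alpha> \<alpha>"
proof (induction m)
  case 0
  \<comment> \<open>This product is what \<open>M ^\<^sub>m 1\<close> unfolds to.\<close>
  have "1\<^sub>m (dim_row M) * M = M" using M by simp
  then show ?case by simp
next
  case (Suc m)
  have "minor M \<alpha> \<alpha> ^ 2 ^ Suc m = (minor M \<alpha> \<alpha> ^ 2 ^ m)\<^sup>2"
    by (simp add: power_mult[symmetric] mult.commute)
  also have "\<dots> \<le> (minor (M ^\<^sub>m 2 ^ m) \<alpha> \<alpha>)\<^sup>2"
    using Suc nonneg by (intro power_mono) auto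
  also have "\<dots> \<le> minor (M ^\<^sub>m 2 ^ m * M ^\<^sub>m 2 ^ m) \<alpha> \<alpha>"
    using M by (intro sign_symmetric_minor_square[OF _ sym \<alpha> k]) auto
  also have "M ^\<^sub>m 2 ^ m * M ^\<^sub>m 2 ^ m = M ^\<^sub>m 2 ^ Suc m"
    by (simp add: pow_mat_add[OF M, symmetric] mult_2)
  finally show ?case .
qed

section \<open>Convergence of minors\<close>

text \<open>By the Leibniz formula a minor is a polynomial in the entries, so entrywise convergence
  suffices.\<close>

lemma tendsto_minor:
  assumes M: "\<And>x. M x \<in> carrier_mat n n" and L: "L \<in> carrier_mat n n"
    and lim: "\<And>i j. i < n \<Longrightarrow> j < n \<Longrightarrow> ((\<lambda>x. M x $$ (i, j)) \<longlongrightarrow> L $$ (i, j)) F"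
    and \<alpha>: "\<alpha> \<in> index_sets k n" and \<beta>: "\<beta> \<in> index_sets k n"
  shows "((\<lambda>x. minor (M x) \<alpha> \<beta>) \<longlongrightarrow> minor L \<alpha> \<beta>) F"
proof -
  have entry: "((\<lambda>x. submatrix (M x) \<alpha> \<beta> $$ (i, j)) \<longlongrightarrow> submatrix L \<alpha> \<beta> $$ (i, j)) F"
    if "i < k" "j < k" for i j
    unfolding submatrix_index'[OF M \<alpha> \<beta> that] submatrix_index'[OF L \<alpha> \<beta> that]
    using lim pick_less[OF \<alpha> that(1)] pick_less[OF \<beta> that(2)] by blast
  show ?thesis
    unfolding minor_def det_def'[OF submatrix_carrier[OF M \<alpha> \<beta>]] det_def'[OF submatrix_carrier[OF L \<alpha> \<beta>]]
    by (intro tendsto_intros entry) (auto dest: permutes_in_image)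
qed

section \<open>Principal minors near the identity\<close>

lemma minor_one:
  assumes \<alpha>: "\<alpha> \<in> index_sets k n"
  shows "minor (1\<^sub>m n) \<alpha> \<alpha> = 1"
proof -
  have "submatrix (1\<^sub>m n) \<alpha> \<alpha> = (1\<^sub>m k :: real mat)"
  proof (rule eq_matI)
    fix i j assume "i < dim_row (1\<^sub>m k :: real mat)" "j < dim_col (1\<^sub>m k :: real mat)"
    then show "submatrix (1\<^sub>m n) \<alpha> \<alpha> $$ (i, j) = (1\<^sub>m k :: real mat) $$ (i, j)"
      using pick_less[OF \<alpha>] inj_on_eq_iff[OF pick_inj_on[of \<alpha>], of i j] index_setsD(2)[OF \<alpha>]
      by (simp add: submatrix_index'[OF one_carrier_mat \<alpha> \<alpha>])
  qed (use submatrix_carrier[OF one_carrier_mat \<alpha> \<alpha>] in auto)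
  then show ?thesis by (simp add: minor_def)
qed

lemma minor_one_plus_smult_differentiable:
  fixes A :: "real mat"
  assumes A: "A \<in> carrier_mat n n" and \<alpha>: "\<alpha> \<in> index_sets k n"
  shows "(\<lambda>x. minor (1\<^sub>m n + x \<cdot>\<^sub>m A) \<alpha> \<alpha>) differentiable at a"
proof -
  have M: "1\<^sub>m n + x \<cdot>\<^sub>m A \<in> carrier_mat n n" for x using A by simp
  have entry: "(\<lambda>x. submatrix (1\<^sub>m n + x \<cdot>\<^sub>m A) \<alpha> \<alpha> $$ (i, j)) differentiable at a"
    if "i < k" "j < k" for i j
    unfolding submatrix_index'[OF M \<alpha> \<alpha> that]
    using A pick_less[OF \<alpha> that(1)] pick_less[OF \<alpha> that(2)] by simp
  \<comment> \<open>One factor is added at a time; \<open>m \<le> k\<close> keeps the row index in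
    range, and \<open>p\<close> then keeps the column index in range.\<close>
  have prod: "(\<lambda>x. \<Prod>i\<in>{0..<m}. submatrix (1\<^sub>m n + x \<cdot>\<^sub>m A) \<alpha> \<alpha> $$ (i, p i)) differentiable at a"
    if "p permutes {0..<k}" "m \<le> k" for p m
    using that(2)
  proof (induction m)
    case (Suc m)
    then show ?case
      using permutes_in_image[OF that(1), of m]
      by (auto intro!: differentiable_mult entry)
  qed simp
  show ?thesis
    unfolding minor_def det_def'[OF submatrix_carrier[OF M \<alpha> \<alpha>]]
    by (intro differentiable_sum differentiable_mult differentiable_const prod ballI)
      (auto simp: finite_permutations)
qed

text \<open>The minor equals 1 at \<open>x = 0\<close>, and near 0 its difference quotient stays
  within 1 of the derivative \<open>D\<close>. This gives \<open>C = \<bar>D\<bar> + 1\<close>,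
  whatever the value of \<open>D\<close>.\<close>

lemma minor_one_plus_smult_lower_bound:
  fixes A :: "real mat"
  assumes A: "A \<in> carrier_mat n n" and \<alpha>: "\<alpha> \<in> index_sets k n"
  obtains C where "\<forall>\<^sub>F x in nhds 0. 1 - C * \<bar>x\<bar> \<le> minor (1\<^sub>m n + x \<cdot>\<^sub>m A) \<alpha> \<alpha>"
proof -
  let ?f = "\<lambda>x. minor (1\<^sub>m n + x \<cdot>\<^sub>m A) \<alpha> \<alpha>"
  have "1\<^sub>m n + 0 \<cdot>\<^sub>m A = 1\<^sub>m n" using A by (intro eq_matI) auto
  then have f0: "?f 0 = 1" using minor_one[OF \<alpha>] by simp
  obtain D where "(?f has_real_derivative D) (at 0)"
    using minor_one_plus_smult_differentiable[OF A \<alpha>] by (meson real_differentiable_def)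
  then have "((\<lambda>x. (?f x - 1) / x) \<longlongrightarrow> D) (at 0)"
    by (simp add: has_field_derivative_iff f0)
  then have "\<forall>\<^sub>F x in at 0. dist ((?f x - 1) / x) D < 1"
    by (rule tendstoD) simp
  then have "\<forall>\<^sub>F x in at 0. 1 - (\<bar>D\<bar> + 1) * \<bar>x\<bar> \<le> ?f x"
    using eventually_neq_at_within[of 0 0 UNIV]
  proof eventually_elim
    case (elim x)
    then have "\<bar>(?f x - 1) / x\<bar> \<le> \<bar>D\<bar> + 1" by (simp add: dist_real_def)
    then have "\<bar>?f x - 1\<bar> \<le> (\<bar>D\<bar> + 1) * \<bar>x\<bar>" using elim by (simp add: field_simps)
    then show ?case by linarith
  qed
  \<comment> \<open>At \<open>x = 0\<close> the bound reads \<open>1 \<le> 1\<close>, so the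
    punctured neighbourhood can be filled in. This covers \<open>t = 0\<close> later, where every
    step size is 0.\<close>
  then have "\<forall>\<^sub>F x in nhds 0. 1 - (\<bar>D\<bar> + 1) * \<bar>x\<bar> \<le> ?f x"
    by (simp add: eventually_nhds_conv_at f0)
  then show ?thesis by (rule that)
qed

section \<open>The exponential as a limit of powers\<close>

text \<open>This is the binomial theorem for the commuting matrices \<open>1\<^sub>m n\<close> and
  \<open>x \<cdot>\<^sub>m B\<close>, put entrywise so that the limit becomes one of real
  series.\<close>

lemma one_plus_smult_pow_entry:
  fixes B :: "real mat"
  assumes B: "B \<in> carrier_mat n n" and i: "i < n" and j: "j < n"
  shows "((1\<^sub>m n + x \<cdot>\<^sub>m B) ^\<^sub>m m) $$ (i, j)
    = (\<Sum>k\<le>m. real (m choose k) * x ^ k * (B ^\<^sub>m k) $$ (i, j))"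
  using j
proof (induction m arbitrary: j)
  case 0
  then show ?case using B by simp
next
  case (Suc m)
  let ?M = "1\<^sub>m n + x \<cdot>\<^sub>m B"
  define b where "b k l = (B ^\<^sub>m k) $$ (i, l)" for k l
  have M: "?M \<in> carrier_mat n n" using B by simp
  have b_Suc: "b (Suc k) j = (\<Sum>l<n. b k l * B $$ (l, j))" for k
    using B i Suc.prems by (simp add: b_def scalar_prod_def atLeast0LessThan)
  have "(?M ^\<^sub>m Suc m) $$ (i, j) = (\<Sum>l<n. (?M ^\<^sub>m m) $$ (i, l) * ?M $$ (l, j))"
    using M B i Suc.prems by (simp add: scalar_prod_def atLeast0LessThan)
  also have "\<dots> = (\<Sum>l<n. (if l = j then (?M ^\<^sub>m m) $$ (i, l) else 0)
      + x * ((?M ^\<^sub>m m) $$ (i, l) * B $$ (l, j)))"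
    using B Suc.prems by (intro sum.cong) (auto simp: algebra_simps)
  also have "\<dots> = (?M ^\<^sub>m m) $$ (i, j) + x * (\<Sum>l<n. (?M ^\<^sub>m m) $$ (i, l) * B $$ (l, j))"
    using Suc.prems by (simp add: sum.distrib sum_distrib_left)
  also have "(\<Sum>l<n. (?M ^\<^sub>m m) $$ (i, l) * B $$ (l, j))
      = (\<Sum>l<n. \<Sum>k\<le>m. real (m choose k) * x ^ k * (b k l * B $$ (l, j)))"
    by (intro sum.cong) (auto simp: Suc.IH b_def sum_distrib_right mult.assoc)
  also have "\<dots> = (\<Sum>k\<le>m. real (m choose k) * x ^ k * b (Suc k) j)"
    by (subst sum.swap) (simp add: b_Suc sum_distrib_left)
  also have "(?M ^\<^sub>m m) $$ (i, j) = (\<Sum>k\<le>m. real (m choose k) * x ^ k * b k j)"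
    using Suc by (simp add: b_def)
  \<comment> \<open>The added term has coefficient \<open>m choose Suc m = 0\<close>. It aligns the
    index ranges, so that after a shift the two sums combine by Pascal's rule.\<close>
  also have "\<dots> = (\<Sum>k\<le>Suc m. real (m choose k) * x ^ k * b k j)"
    by (simp add: binomial_eq_0)
  also have "\<dots> = b 0 j + (\<Sum>k\<le>m. real (m choose Suc k) * x ^ Suc k * b (Suc k) j)"
    by (subst sum.atMost_Suc_shift) simp
  also have "\<dots> + x * (\<Sum>k\<le>m. real (m choose k) * x ^ k * b (Suc k) j)
      = b 0 j + (\<Sum>k\<le>m. real (Suc m choose Suc k) * x ^ Suc k * b (Suc k) j)"
    by (simp add: sum_distrib_left sum.distrib[symmetric] algebra_simps)
  also have "\<dots> = (\<Sum>k\<le>Suc m. real (Suc m choose k) * x ^ k * b k j)"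
    by (subst sum.atMost_Suc_shift) simp
  finally show ?case by (simp add: b_def)
qed

text \<open>The number \<open>fact k * (m choose k)\<close> counts injective sequences of length
  \<open>k\<close> in a set of size \<open>m\<close>, so it is at most \<open>m ^ k\<close>. The
  bound is uniform in \<open>m\<close>, as domination requires. For \<open>m = 0\<close> and
  \<open>k > 0\<close> the quotient is 0 by the convention on division.\<close>

lemma choose_div_power_le: "real (m choose k) / real m ^ k \<le> 1 / fact k"
proof (cases "m = 0")
  case True
  then show ?thesis by (cases k) auto
next
  case False
  have "real (fact k * (m choose k)) \<le> real (m ^ k)"
    unfolding of_nat_le_iff using binomial_fact_pow by (simp add: mult.commute)
  then show ?thesis using False by (simp add: field_simps)
qed

text \<open>For \<open>m > 0\<close> the quotient is the product of the factors
  \<open>1 - i / m\<close> over \<open>i < k\<close>, divided by \<open>fact k\<close>. The number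
  of factors is fixed and each tends to 1.\<close>

lemma choose_div_power_tendsto:
  "(\<lambda>m. real (m choose k) / real m ^ k) \<longlonglongrightarrow> 1 / fact k"
proof -
  have "(\<lambda>m. (\<Prod>i<k. 1 - real i / real m) / fact k) \<longlonglongrightarrow> (\<Prod>i<k. 1 - 0) / fact k"
    by (intro tendsto_divide tendsto_prod tendsto_diff tendsto_const lim_const_over_n) simp
  moreover have "\<forall>\<^sub>F m in sequentially.
      (\<Prod>i<k. 1 - real i / real m) / fact k = real (m choose k) / real m ^ k"
    using eventually_gt_at_top[of 0]
  proof eventually_elim
    case (elim m)
    have "real (m choose k) = (\<Prod>i<k. real m - real i) / fact k"
      by (simp add: binomial_gbinomial gbinomial_prod_rev atLeast0LessThan)
    moreover have "(\<Prod>i<k. real m - real i) = (\<Prod>i<k. real m * (1 - real i / real m))"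
      using elim by (intro prod.cong) (auto simp: field_simps)
    ultimately show ?case using elim by (simp add: prod.distrib)
  qed
  ultimately show ?thesis by (simp add: tendsto_cong)
qed

text \<open>The binomial expansion at \<open>x = 1 / m\<close> has terms tending to those of the
  exponential series. Tannery's theorem, dominated convergence for series, allows the passage to the
  limit term by term, with the series of \<open>exp (n * c)\<close> as majorant.\<close>

lemma mat_exp_limit:
  fixes B :: "real mat"
  assumes B: "B \<in> carrier_mat n n" and i: "i < n" and j: "j < n"
  shows "(\<lambda>m. ((1\<^sub>m n + (1 / real m) \<cdot>\<^sub>m B) ^\<^sub>m m) $$ (i, j)) \<longlonglongrightarrow> mat_exp B $$ (i, j)"
proof -
  define c where "c = (\<Sum>p\<in>{..<n} \<times> {..<n}. \<bar>B $$ p\<bar>)"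
  have c: "\<bar>B $$ (i, j)\<bar> \<le> c" if "i < n" "j < n" for i j
    unfolding c_def by (rule member_le_sum) (use that in auto)
  define a where "a k m = real (m choose k) / real m ^ k * (B ^\<^sub>m k) $$ (i, j)" for k m
  have bound: "norm (a k m) \<le> inverse (fact k) * (real n * c) ^ k" for k m
    unfolding a_def norm_mult
    using choose_div_power_le[of m k] pow_mat_entry_bound[OF B c i j, of k]
    by (intro mult_mono) (auto simp: divide_inverse)
  have lim: "(\<lambda>m. a k m) \<longlonglongrightarrow> 1 / fact k * (B ^\<^sub>m k) $$ (i, j)" for k
    unfolding a_def by (intro tendsto_mult choose_div_power_tendsto tendsto_const)
  have "(\<lambda>m. \<Sum>k. a k m) \<longlonglongrightarrow> (\<Sum>k. 1 / fact k * (B ^\<^sub>m k) $$ (i, j))"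
    using tannerys_theorem[OF lim always_eventually summable_exp[of "real n * c"]] bound by simp
  \<comment> \<open>The binomial coefficient vanishes for \<open>k > m\<close>, so the series is the
    finite expansion.\<close>
  moreover have "(\<Sum>k. a k m) = ((1\<^sub>m n + (1 / real m) \<cdot>\<^sub>m B) ^\<^sub>m m) $$ (i, j)" for m
    unfolding one_plus_smult_pow_entry[OF B i j]
    by (subst suminf_finite[of "{..m}"])
      (auto simp: a_def binomial_eq_0 power_one_over intro!: sum.cong)
  ultimately show ?thesis using B i j by (simp add: mat_exp_def)
qed

section \<open>Positivity of the principal minors of the exponential\<close>

theorem theorem11:
  fixes A :: "real mat" and n :: nat
  assumes "A \<in> carrier_mat n n"
    and "\<exists>\<epsilon>bar > 0. \<forall>\<epsilon>\<in>{0..\<epsilon>bar}. \<forall>l::nat. l > 0 \<longrightarrow>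
           sign_symmetric ((1\<^sub>m n + \<epsilon> \<cdot>\<^sub>m A) ^\<^sub>m l)"
  shows "EP_matrix A"
proof -
  note A = assms(1)
  obtain e where e: "e > 0"
    and sym: "\<And>\<epsilon> l. 0 \<le> \<epsilon> \<Longrightarrow> \<epsilon> \<le> e \<Longrightarrow> l > 0 \<Longrightarrow> sign_symmetric ((1\<^sub>m n + \<epsilon> \<cdot>\<^sub>m A) ^\<^sub>m l)"
    using assms(2) by auto
  have pos: "minor (mat_exp (t \<cdot>\<^sub>m A)) \<alpha> \<alpha> > 0"
    if t: "t \<ge> 0" and k: "k > 0" and \<alpha>: "\<alpha> \<in> index_sets k n" for t k \<alpha>
  proof -
    have tA: "t \<cdot>\<^sub>m A \<in> carrier_mat n n" using A by simp
    obtain C where C: "\<forall>\<^sub>F x in nhds 0. 1 - C * \<bar>x\<bar> \<le> minor (1\<^sub>m n + x \<cdot>\<^sub>m A) \<alpha> \<alpha>"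
      using minor_one_plus_smult_lower_bound[OF A \<alpha>] .
    \<comment> \<open>Repeated squaring reaches only the exponents \<open>2 ^ m\<close>, so all
      limits are taken along this subsequence.\<close>
    have sub: "filterlim (\<lambda>m. 2 ^ m :: nat) sequentially sequentially"
      by (rule filterlim_subseq) (simp add: strict_mono_def)
    define \<epsilon> where "\<epsilon> m = t / 2 ^ m" for m :: nat
    have \<epsilon>0: "\<epsilon> \<longlonglongrightarrow> 0"
      using filterlim_compose[OF lim_const_over_n[of t] sub] by (simp add: \<epsilon>_def[abs_def])
    \<comment> \<open>The sign of \<open>C\<close> is unknown. Positivity of
      \<open>1 - C * \<epsilon> m\<close> permits raising the bound to a power and makes the minor
      nonnegative.\<close>
    have "(\<lambda>m. 1 - C * \<epsilon> m) \<longlonglongrightarrow> 1 - C * 0" by (intro tendsto_intros \<epsilon>0)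
    then have "\<forall>\<^sub>F m in sequentially. 1 - C * \<epsilon> m > 0"
      by (rule order_tendstoD) simp
    moreover have "\<forall>\<^sub>F m in sequentially. \<epsilon> m < e"
      using order_tendstoD(2)[OF \<epsilon>0 e] .
    moreover have "\<forall>\<^sub>F m in sequentially.
        1 - C * \<bar>\<epsilon> m\<bar> \<le> minor (1\<^sub>m n + \<epsilon> m \<cdot>\<^sub>m A) \<alpha> \<alpha>"
      using filterlim_iff[THEN iffD1, OF \<epsilon>0] C by blast
    \<comment> \<open>The left side is written as \<open>(1 + x / N) ^ N\<close> with
      \<open>x = - (C * t)\<close> and \<open>N = 2 ^ m\<close>, the form whose limit is
      \<open>exp x\<close>.\<close>
    ultimately have bound: "\<forall>\<^sub>F m in sequentially.
        (1 + - (C * t) / real (2 ^ m)) ^ 2 ^ m \<le> minor ((1\<^sub>m n + \<epsilon> m \<cdot>\<^sub>m A) ^\<^sub>m 2 ^ m) \<alpha> \<alpha>"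
    proof eventually_elim
      case (elim m)
      have ge0: "\<epsilon> m \<ge> 0" using t by (simp add: \<epsilon>_def)
      have "(1 + - (C * t) / real (2 ^ m)) ^ 2 ^ m = (1 - C * \<epsilon> m) ^ 2 ^ m"
        by (simp add: \<epsilon>_def)
      also have "\<dots> \<le> minor (1\<^sub>m n + \<epsilon> m \<cdot>\<^sub>m A) \<alpha> \<alpha> ^ 2 ^ m"
        using elim ge0 by (intro power_mono) auto
      also have "\<dots> \<le> minor ((1\<^sub>m n + \<epsilon> m \<cdot>\<^sub>m A) ^\<^sub>m 2 ^ m) \<alpha> \<alpha>"
        using A elim ge0 by (intro sign_symmetric_minor_power[OF _ sym \<alpha> k]) auto
      finally show ?case .
    qed
    have "(1 / real (2 ^ m)) \<cdot>\<^sub>m (t \<cdot>\<^sub>m A) = \<epsilon> m \<cdot>\<^sub>m A" for m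
      by (intro eq_matI) (auto simp: \<epsilon>_def)
    then have entry: "(\<lambda>m. ((1\<^sub>m n + \<epsilon> m \<cdot>\<^sub>m A) ^\<^sub>m 2 ^ m) $$ (i, j)) \<longlonglongrightarrow> mat_exp (t \<cdot>\<^sub>m A) $$ (i, j)"
      if "i < n" "j < n" for i j
      using filterlim_compose[OF mat_exp_limit[OF tA that] sub] by simp
    have "(\<lambda>m. minor ((1\<^sub>m n + \<epsilon> m \<cdot>\<^sub>m A) ^\<^sub>m 2 ^ m) \<alpha> \<alpha>) \<longlonglongrightarrow> minor (mat_exp (t \<cdot>\<^sub>m A)) \<alpha> \<alpha>"
      by (rule tendsto_minor[OF _ _ entry \<alpha> \<alpha>]) (use A in \<open>auto simp: mat_exp_def\<close>)
    moreover have "(\<lambda>m. (1 + - (C * t) / real (2 ^ m)) ^ 2 ^ m) \<longlonglongrightarrow> exp (- (C * t))"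
      using filterlim_compose[OF tendsto_exp_limit_sequentially sub] .
    \<comment> \<open>A limit preserves only the weak inequality; strictness comes from the positive
      limit of the lower bounds.\<close>
    ultimately have "exp (- (C * t)) \<le> minor (mat_exp (t \<cdot>\<^sub>m A)) \<alpha> \<alpha>"
      using bound by (intro tendsto_le[OF sequentially_bot])
    then show ?thesis using exp_gt_zero order_less_le_trans by blast
  qed
  show ?thesis
    unfolding EP_matrix_def P_matrix_def
  proof (intro conjI allI impI ballI)
    fix t :: real and k \<alpha>
    assume "t \<ge> 0" "k \<in> {1..dim_row (mat_exp (t \<cdot>\<^sub>m A))}"
      "\<alpha> \<in> index_sets k (dim_row (mat_exp (t \<cdot>\<^sub>m A)))"
    then show "minor (mat_exp (t \<cdot>\<^sub>m A)) \<alpha> \<alpha> > 0"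
      using pos[of t k \<alpha>] A by (simp add: mat_exp_def)
  qed (use A in \<open>auto simp: mat_exp_def\<close>)
qed

end
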